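(* For every $n\ge1$, the number $M'\setminus N'(n,2)$ of 2-ball strict multiplex prime juggling patterns of period $n$ satisfies $$M'\setminus N'(n,2)=\sum_{t\ge1}\Big(\sum_{m=1}^{n-1}t\cdot c_t(m)\Big)+1.$$
   Context: A 2-ball multiplex state is a sequence $\alpha=(\alpha_1,\alpha_2,\dots)$ with $\alpha_i\in\{0,1,2\}$, finitely many nonzero, $\sum_i\alpha_i=2$. There is a transition $\alpha\to\beta$ iff $\alpha_{i+1}\le\beta_i$ for all $i\ge1$. A 2-ball multiplex prime juggling pattern of period $n$ is a directed cycle of length $n$ in this state graph (closed walk of length $n$ visiting $n$ distinct states), counted up to cyclic rotation. It is normal if all its states have entries in $\{0,1\}$, and strict multiplex otherwise. For integers $t,m\ge1$, $$c_t(m)=\sum_{\substack{p_1>\cdots>p_t\ge1\\ p_1+\cdots+p_t=m}}\frac{1}{t(t+1)}\prod_{i=1}^t\Big(\frac{i+1}{i}\Big)^{p_i}.$$ *)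

theory Defs
  imports "HOL-Analysis.Infinite_Sum"
begin

text \<open>
  States are 0-based: \<open>a i\<close> is the paper's \<open>\<alpha>\<^sub>i\<^sub>+\<^sub>1\<close>, the number of balls landing \<open>i + 1\<close> beats from now.
\<close>

definition multiplex_state :: "(nat \<Rightarrow> nat) \<Rightarrow> bool" where
  "multiplex_state a \<longleftrightarrow>
     (\<forall>i. a i \<in> {0, 1, 2}) \<and> finite {i. a i \<noteq> 0} \<and> (\<Sum>i\<in>{i. a i \<noteq> 0}. a i) = 2"

definition transition :: "(nat \<Rightarrow> nat) \<Rightarrow> (nat \<Rightarrow> nat) \<Rightarrow> bool" where
  "transition a b \<longleftrightarrow> multiplex_state a \<and> multiplex_state b \<and> (\<forall>i. a (Suc i) \<le> b i)"

text \<open>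
  A closed walk is the list of its successive states with a marked starting point; the walk
  returns from the last state to the first. A loop is a cycle of length 1.
\<close>

definition prime_closed_walk :: "nat \<Rightarrow> (nat \<Rightarrow> nat) list \<Rightarrow> bool" where
  "prime_closed_walk n w \<longleftrightarrow>
     length w = n \<and> distinct w \<and> (\<forall>i<n. transition (w ! i) (w ! (Suc i mod n)))"

definition normal_walk :: "(nat \<Rightarrow> nat) list \<Rightarrow> bool" where
  "normal_walk w \<longleftrightarrow> (\<forall>a\<in>set w. \<forall>i. a i \<in> {0, 1})"

definition rotation_rel :: "('a list \<times> 'a list) set" where
  "rotation_rel = {(v, w). \<exists>k. w = rotate k v}"

definition strict_multiplex_prime_patterns :: "nat \<Rightarrow> (nat \<Rightarrow> nat) list set set" where
  "strict_multiplex_prime_patterns n =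
     {w. prime_closed_walk n w \<and> \<not> normal_walk w} // rotation_rel"

definition distinct_partitions :: "nat \<Rightarrow> nat \<Rightarrow> nat list set" where
  "distinct_partitions t m =
     {p. length p = t \<and> sorted_wrt (>) p \<and> (\<forall>x\<in>set p. x \<ge> 1) \<and> sum_list p = m}"

text \<open>The paper's \<open>p\<^sub>i\<close> is \<open>p ! (i - 1)\<close>.\<close>

definition c :: "nat \<Rightarrow> nat \<Rightarrow> real" where
  "c t m = (\<Sum>p\<in>distinct_partitions t m.
     1 / (real t * (real t + 1)) * (\<Prod>i=1..t. ((real i + 1) / real i) ^ (p ! (i - 1))))"

text \<open>
  The two facts below show that neither convention for undefined sums is
  ever used: the sum defining \<open>c\<close> is finite, and the sum over all \<open>t\<close> has finite support.
\<close>

lemma length_le_sum_list: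
  fixes p :: "nat list"
  shows "\<forall>x\<in>set p. x \<ge> 1 \<Longrightarrow> length p \<le> sum_list p"
  by (induction p) auto

lemma finite_distinct_partitions: "finite (distinct_partitions t m)"
proof (rule finite_subset)
  show "distinct_partitions t m \<subseteq> {p. set p \<subseteq> {..m} \<and> length p = t}"
    by (auto simp: distinct_partitions_def member_le_sum_list)
qed (simp add: finite_lists_length_eq)

lemma c_eq_0: "m < t \<Longrightarrow> c t m = 0"
proof -
  assume "m < t"
  then have "distinct_partitions t m = {}"
    using length_le_sum_list by (force simp: distinct_partitions_def)
  then show ?thesis by (simp add: c_def)
qed

lemma c_sum_summable: "(\<lambda>t. \<Sum>m=1..n-1. real t * c t m) summable_on A"
proof (rule finite_nonzero_values_imp_summable_on)
  have "(\<Sum>m=1..n-1. real t * c t m) = 0" if "t > n" for t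
    using that by (intro sum.neutral) (auto simp: c_eq_0)
  then have "{t \<in> A. (\<Sum>m=1..n-1. real t * c t m) \<noteq> 0} \<subseteq> {..n}"
    by (auto simp: not_less[symmetric])
  then show "finite {t \<in> A. (\<Sum>m=1..n-1. real t * c t m) \<noteq> 0}"
    using finite_subset by blast
qed

end

theory Submission
  imports Defs "HOL-Combinatorics.Multiset_Permutations"
begin

text \<open>
  Write a state as the pair \<open>(k, d)\<close> of its lowest ball position \<open>k\<close> and the distance \<open>d\<close> between
  the two balls. A strict multiplex cycle contains a state \<open>(k, 0)\<close>, hence also \<open>(0, 0)\<close>, and
  cutting it there turns it into a walk ending in \<open>(0, 0)\<close>. From \<open>(0, d)\<close> with \<open>d > 0\<close> one can jump
  to \<open>(d - 1, e)\<close> for any \<open>e\<close>, or to \<open>(d - 1 - e, e)\<close> for \<open>0 < e < d\<close>; grouping the distances linked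
  by jumps of the second kind into decreasing blocks, the walk is encoded by a list of disjoint
  blocks, and its length is one plus the lowest position of its first state plus the sum of the
  block maxima. Given \<open>t\<close> maxima \<open>p\<^sub>1 > \<dots> > p\<^sub>t\<close>, there are \<open>t!\<close> orders of the blocks, and every
  other number \<open>j\<close> lies in no block or in one of the blocks whose maximum exceeds \<open>j\<close>.
\<close>

section \<open>States as pairs\<close>

text \<open>The two indicators add up to 2 when the distance is 0, so a double ball needs no
  separate case.\<close>

definition pair_state :: "nat \<times> nat \<Rightarrow> nat \<Rightarrow> nat" where
  "pair_state x i = of_bool (i = fst x) + of_bool (i = fst x + snd x)"

text \<open>While no ball is at position 0 the next state is forced. At \<open>(0, 0)\<close> both
  balls are thrown freely. At \<open>(0, Suc d)\<close> one ball is thrown, while the other moves to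
  \<open>d\<close> and becomes the lower or the upper ball of the next state.\<close>

fun pair_step :: "nat \<times> nat \<Rightarrow> nat \<times> nat \<Rightarrow> bool" where
  "pair_step (Suc k, d) y \<longleftrightarrow> y = (k, d)"
| "pair_step (0, 0) y \<longleftrightarrow> True"
| "pair_step (0, Suc d) y \<longleftrightarrow> fst y = d \<or> fst y + snd y = d"

text \<open>The support of \<open>pair_state (k, d)\<close> is \<open>{k, k + d}\<close>, and its
  minimum and maximum determine \<open>k\<close> and \<open>d\<close>.\<close>

lemma inj_pair_state: "inj pair_state"
proof (rule injI)
  fix x y assume eq: "pair_state x = pair_state y"
  obtain k d l e where xy: "x = (k, d)" "y = (l, e)" by fastforce
  have *: "pair_state (k, d) i = pair_state (l, e) i" for i
    using eq xy by simp
  have pos: "pair_state (k, d) i \<noteq> 0 \<longleftrightarrow> i = k \<or> i = k + d" for k d i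
    by (simp add: pair_state_def)
  have "k = l \<or> k = l + e" "l = k \<or> l = k + d"
    using *[of k] *[of l] pos by metis+
  then have "k = l" by linarith
  moreover have "k + d = l \<or> k + d = l + e" "l + e = k \<or> l + e = k + d"
    using *[of "k + d"] *[of "l + e"] pos by metis+
  ultimately show "x = y"
    using xy by auto
qed

lemma sum_indicator_superset:
  fixes a :: "nat \<Rightarrow> nat"
  assumes "finite A" "{i. a i \<noteq> 0} \<subseteq> A"
  shows "(\<Sum>i\<in>{i. a i \<noteq> 0}. a i) = (\<Sum>i\<in>A. a i)"
  using assms by (intro sum.mono_neutral_left) auto

lemma multiplex_pair_state: "multiplex_state (pair_state x)"
proof -
  obtain k d where x: "x = (k, d)" by fastforce
  have sub: "{i. pair_state x i \<noteq> 0} \<subseteq> {k, k + d}"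
    by (auto simp: pair_state_def x)
  have "(\<Sum>i\<in>{k, k + d}. pair_state x i) = 2"
    by (cases "d = 0") (auto simp: pair_state_def x)
  then have "(\<Sum>i\<in>{i. pair_state x i \<noteq> 0}. pair_state x i) = 2"
    using sum_indicator_superset[OF _ sub] by simp
  moreover have "finite {i. pair_state x i \<noteq> 0}"
    using sub finite_subset by blast
  ultimately show ?thesis
    by (auto simp: multiplex_state_def pair_state_def of_bool_def)
qed

lemma multiplex_stateE:
  assumes "multiplex_state a"
  obtains x where "a = pair_state x"
proof -
  define A where "A = {i. a i \<noteq> 0}"
  have fin: "finite A" and sum: "(\<Sum>i\<in>A. a i) = 2"
    using assms by (auto simp: multiplex_state_def A_def)
  then have "A \<noteq> {}" by auto
  define k where "k = Min A"
  have k: "k \<in> A" "\<And>i. i \<in> A \<Longrightarrow> k \<le> i"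
    using fin \<open>A \<noteq> {}\<close> by (auto simp: k_def)
  have split1: "a k + (\<Sum>i\<in>A - {k}. a i) = 2"
    using sum fin k by (simp add: sum.remove)
  show thesis
  proof (cases "a k = 2")
    case True
    then have "\<forall>i\<in>A - {k}. a i = 0"
      using split1 fin by simp
    then have "a = pair_state (k, 0)"
      using True by (auto simp: pair_state_def A_def fun_eq_iff)
    then show ?thesis by (rule that)
  next
    case False
    then have ak: "a k = 1"
      using k split1 by (auto simp: A_def)
    then have rest: "(\<Sum>i\<in>A - {k}. a i) = 1"
      using split1 by simp
    then have "A - {k} \<noteq> {}" by force
    then obtain l where l: "l \<in> A" "l \<noteq> k" by auto
    have "a l + (\<Sum>i\<in>A - {k} - {l}. a i) = 1"
      using rest fin l by (simp add: sum.remove)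
    moreover have "a l > 0" using l by (simp add: A_def)
    ultimately have al: "a l = 1" and "(\<Sum>i\<in>A - {k} - {l}. a i) = 0"
      by auto
    then have "\<forall>i\<in>A - {k} - {l}. a i = 0"
      using fin by simp
    moreover have "k < l" using k l by force
    ultimately have "a = pair_state (k, l - k)"
      using ak al by (auto simp: pair_state_def A_def fun_eq_iff)
    then show ?thesis by (rule that)
  qed
qed

text \<open>Shifting \<open>x\<close> keeps two balls unless one sits at 0. Two surviving balls
  already exhaust \<open>y\<close>, which forces equality; one survivor at \<open>d\<close> only
  forces \<open>y\<close> to have a ball there.\<close>

lemma transition_pair_state: "transition (pair_state x) (pair_state y) \<longleftrightarrow> pair_step x y"
proof -
  obtain l e where y: "y = (l, e)" by fastforce
  have "(\<forall>i. pair_state x (Suc i) \<le> pair_state y i) \<longleftrightarrow> pair_step x y"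
  proof (cases "(x, y)" rule: pair_step.cases)
    case (1 k d)
    have "y = (k, d)" if "\<forall>i. pair_state (Suc k, d) (Suc i) \<le> pair_state y i"
      using that[rule_format, of k] that[rule_format, of "k + d"]
      unfolding y by (auto simp: pair_state_def of_bool_def split: if_splits)
    moreover have "\<forall>i. pair_state (Suc k, d) (Suc i) \<le> pair_state (k, d) i"
      by (auto simp: pair_state_def)
    ultimately show ?thesis using 1 by auto
  next
    case 2
    then show ?thesis by (auto simp: pair_state_def)
  next
    case (3 d)
    then show ?thesis
      by (auto simp: pair_state_def y of_bool_def split: if_splits)
  qed
  then show ?thesis
    by (simp add: transition_def multiplex_pair_state)
qed

section \<open>Cutting cycles at the state with both balls in the lowest position\<close>

text \<open>The step closing the cycle is not listed, as \<open>(0, 0)\<close> steps to every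
  state.\<close>

definition cut_walks :: "nat \<Rightarrow> (nat \<times> nat) list set" where
  "cut_walks n = {v. length v = n \<and> distinct v \<and> successively pair_step v \<and>
     v \<noteq> [] \<and> last v = (0, 0)}"

lemma prime_closed_walk_rotate:
  assumes "prime_closed_walk n w"
  shows "prime_closed_walk n (rotate k w)"
proof -
  have "transition (rotate k w ! i) (rotate k w ! (Suc i mod n))" if "i < n" for i
  proof -
    have "transition (w ! ((k + i) mod n)) (w ! (Suc ((k + i) mod n) mod n))"
      using assms that by (auto simp: prime_closed_walk_def)
    moreover have "Suc ((k + i) mod n) mod n = (k + Suc i mod n) mod n"
      by (simp add: mod_Suc_eq mod_add_right_eq)
    moreover have "Suc i mod n < n" using that by simp
    ultimately show ?thesis
      using assms that by (simp add: prime_closed_walk_def nth_rotate)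
  qed
  with assms show ?thesis by (simp add: prime_closed_walk_def)
qed

lemma rotation_rel_rotate: "rotation_rel `` {rotate k w} = rotation_rel `` {w}"
proof (cases "w = []")
  case False
  define j where "j = length w - k mod length w"
  have "(j + k) mod length w = 0"
  proof -
    have "j + k = length w + length w * (k div length w)"
      using False mod_less_divisor[of "length w" k] mult_div_mod_eq[of "length w" k]
      unfolding j_def length_greater_0_conv by linarith
    then show ?thesis by simp
  qed
  then have "rotate j (rotate k w) = w"
    by (simp add: rotate_rotate rotate_id)
  then have "rotate i w = rotate (i + j) (rotate k w)" for i
    by (metis rotate_rotate)
  then show ?thesis
    by (auto simp: rotation_rel_def rotate_rotate)
qed (auto simp: rotation_rel_def)

lemma rotate_to_last:
  assumes "x \<in> set w"
  obtains k where "last (rotate k w) = x"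
proof -
  obtain us vs where "w = us @ x # vs"
    using assms by (metis split_list)
  then have "rotate (length (us @ [x])) w = vs @ us @ [x]"
    using rotate_append[of "us @ [x]" vs] by simp
  then show thesis using that[of "length (us @ [x])"] by simp
qed

text \<open>The last entry of the rotation has index \<open>(k + (n - 1)) mod n\<close> in
  \<open>w\<close>. By distinctness this is \<open>n - 1\<close>, so \<open>n\<close> divides
  \<open>k\<close>.\<close>

lemma distinct_rotate_same_last:
  assumes "distinct w" "last (rotate k w) = last w"
  shows "rotate k w = w"
proof (cases "w = []")
  case False
  define n where "n = length w"
  have "n > 0" using False by (simp add: n_def)
  have "last (rotate k w) = w ! ((k + (n - 1)) mod n)"
    using False by (simp add: last_conv_nth nth_rotate n_def)
  moreover have "last w = w ! (n - 1)"
    using False by (simp add: last_conv_nth n_def)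
  ultimately have "(k + (n - 1)) mod n = n - 1"
    using assms \<open>n > 0\<close> by (simp add: nth_eq_iff_index_eq n_def)
  then have "(k + (n - 1) + 1) mod n = (n - 1 + 1) mod n"
    by (metis mod_add_left_eq)
  then have "k mod n = 0" using \<open>n > 0\<close> by simp
  then show ?thesis by (simp add: rotate_id n_def)
qed simp

text \<open>An entry 2 means a state \<open>(k, 0)\<close>, from which the walk is forced down to
  \<open>(0, 0)\<close>.\<close>

lemma non_normal_contains_double:
  assumes "prime_closed_walk n w" "\<not> normal_walk w"
  shows "pair_state (0, 0) \<in> set w"
proof -
  have down: "pair_state (k, 0) \<in> set w \<Longrightarrow> pair_state (0, 0) \<in> set w" for k
  proof (induction k)
    case (Suc k)
    then obtain i where i: "i < n" "w ! i = pair_state (Suc k, 0)"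
      using assms by (auto simp: prime_closed_walk_def in_set_conv_nth)
    define b where "b = w ! (Suc i mod n)"
    have tr: "transition (pair_state (Suc k, 0)) b"
      using assms i by (auto simp: prime_closed_walk_def b_def)
    then obtain y where y: "b = pair_state y"
      by (auto simp: transition_def elim: multiplex_stateE)
    then have "y = (k, 0)" using tr by (simp add: transition_pair_state)
    moreover have "b \<in> set w"
      using assms i by (auto simp: prime_closed_walk_def b_def)
    ultimately show ?case using Suc.IH y by simp
  qed
  obtain a i where a: "a \<in> set w" "a i \<notin> {0, 1}"
    using assms by (auto simp: normal_walk_def)
  then have "multiplex_state a"
    using assms by (auto simp: prime_closed_walk_def in_set_conv_nth transition_def)
  then obtain k d where "a = pair_state (k, d)"
    by (metis multiplex_stateE prod.exhaust)
  then show ?thesis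
    using a down[of k] by (auto simp: pair_state_def of_bool_def split: if_splits)
qed

text \<open>Each rotation class has exactly one representative ending in \<open>(0, 0)\<close>: this
  state occurs in every strict multiplex cycle, and only once.\<close>

lemma card_strict_multiplex_prime_patterns:
  "card (strict_multiplex_prime_patterns n) = card (cut_walks n)"
proof -
  let ?D = "pair_state (0, 0)"
  let ?f = "\<lambda>v. rotation_rel `` {map pair_state v}"
  have closed: "prime_closed_walk n (map pair_state v)" "\<not> normal_walk (map pair_state v)"
    if v: "v \<in> cut_walks n" for v
  proof -
    have "transition (map pair_state v ! i) (map pair_state v ! (Suc i mod n))" if "i < n" for i
    proof (cases "Suc i = n")
      case True
      then have "v ! i = (0, 0)"
        using v by (auto simp: cut_walks_def last_conv_nth)
      then show ?thesis
        using v that by (simp add: cut_walks_def transition_pair_state)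
    next
      case False
      then show ?thesis
        using v that by (auto simp: cut_walks_def transition_pair_state successively_conv_nth)
    qed
    then show "prime_closed_walk n (map pair_state v)"
      using v inj_pair_state
      by (auto simp: prime_closed_walk_def cut_walks_def distinct_map intro: inj_on_subset)
    have "(0, 0) \<in> set v" using v by (metis (mono_tags, lifting) cut_walks_def last_in_set mem_Collect_eq)
    then have "?D \<in> set (map pair_state v)" by simp
    moreover have "?D 0 \<notin> {0, 1}" by (simp add: pair_state_def)
    ultimately show "\<not> normal_walk (map pair_state v)"
      unfolding normal_walk_def by blast
  qed
  have "inj_on ?f (cut_walks n)"
  proof (rule inj_onI)
    fix u v assume u: "u \<in> cut_walks n" and v: "v \<in> cut_walks n" and "?f u = ?f v"
    then have "map pair_state v \<in> ?f u"
      by (auto simp: rotation_rel_def intro: exI[of _ 0])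
    then obtain k where "map pair_state v = rotate k (map pair_state u)"
      by (auto simp: rotation_rel_def)
    then have "map pair_state v = map pair_state (rotate k u)"
      by (simp add: rotate_map)
    then have "v = rotate k u"
      by (rule map_injective[OF _ inj_pair_state])
    then show "u = v"
      using u v distinct_rotate_same_last[of u k] by (simp add: cut_walks_def)
  qed
  moreover have "?f ` cut_walks n = strict_multiplex_prime_patterns n"
  proof (intro subset_antisym subsetI)
    fix c assume "c \<in> ?f ` cut_walks n"
    then show "c \<in> strict_multiplex_prime_patterns n"
      using closed by (auto simp: strict_multiplex_prime_patterns_def intro!: quotientI)
  next
    fix c assume "c \<in> strict_multiplex_prime_patterns n"
    then obtain w where w: "prime_closed_walk n w" "\<not> normal_walk w" and c: "c = rotation_rel `` {w}"
      by (auto simp: strict_multiplex_prime_patterns_def elim: quotientE)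
    obtain k where k: "last (rotate k w) = ?D"
      using rotate_to_last[OF non_normal_contains_double[OF w]] .
    define u where "u = rotate k w"
    have u: "prime_closed_walk n u"
      using w by (simp add: u_def prime_closed_walk_rotate)
    have "u \<noteq> []"
      using non_normal_contains_double[OF w] by (auto simp: u_def)
    have "set u \<subseteq> range pair_state"
    proof
      fix a assume "a \<in> set u"
      then have "multiplex_state a"
        using u by (auto simp: prime_closed_walk_def in_set_conv_nth transition_def)
      then show "a \<in> range pair_state" by (auto elim: multiplex_stateE)
    qed
    then obtain v where v: "u = map pair_state v"
      by (metis ex_map_conv image_iff subset_iff)
    have "pair_state (last v) = ?D"
      using k v \<open>u \<noteq> []\<close> by (simp add: u_def last_map)
    then have "last v = (0, 0)"
      using inj_pair_state by (simp add: inj_eq)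
    moreover have "pair_step (v ! i) (v ! Suc i)" if "Suc i < n" for i
    proof -
      have "transition (u ! i) (u ! (Suc i mod n))"
        using u Suc_lessD[OF that] by (simp add: prime_closed_walk_def)
      then show ?thesis
        using u that by (simp add: v prime_closed_walk_def transition_pair_state)
    qed
    ultimately have "v \<in> cut_walks n"
      using u v \<open>u \<noteq> []\<close>
      by (auto simp: cut_walks_def prime_closed_walk_def successively_conv_nth distinct_map)
    moreover have "c = ?f v"
      using c v rotation_rel_rotate[of k w] by (simp add: u_def)
    ultimately show "c \<in> ?f ` cut_walks n" by blast
  qed
  ultimately show ?thesis
    by (metis card_image)
qed

section \<open>Walks as lists of decreasing blocks\<close>

definition block_list :: "nat list list \<Rightarrow> bool" where
  "block_list bs \<longleftrightarrow> (\<forall>ds\<in>set bs. ds \<noteq> [] \<and> sorted_wrt (>) ds \<and> 0 \<notin> set ds)"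

text \<open>Blocks are decreasing, so \<open>hd\<close> is the block maximum.\<close>

definition disjoint_block_lists :: "nat \<Rightarrow> nat list list set" where
  "disjoint_block_lists m =
     {bs. block_list bs \<and> distinct (concat bs) \<and> sum_list (map hd bs) = m}"

text \<open>
  The walk starting at lowest position \<open>k\<close> and visiting the distances \<open>concat bs\<close> in turn;
  inside a block the jumps are of the second kind, between blocks of the first kind.
\<close>

function block_walk :: "nat \<Rightarrow> nat list list \<Rightarrow> (nat \<times> nat) list" where
  "block_walk (Suc k) bs = (Suc k, if bs = [] then 0 else hd (hd bs)) # block_walk k bs"
| "block_walk 0 [] = [(0, 0)]"
| "block_walk 0 ([] # bs) = []"
| "block_walk 0 ([d] # bs) = (0, d) # block_walk (d - 1) bs"
| "block_walk 0 ((d # e # ds) # bs) = (0, d) # block_walk (d - 1 - e) ((e # ds) # bs)"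
  by pat_completeness auto
termination
  \<comment> \<open>Lexicographic: a descent keeps the blocks and lowers \<open>k\<close>; the other
    recursive calls consume one distance.\<close>
  by (relation "measures [\<lambda>(k, bs). sum_list (map length bs), \<lambda>(k, bs). k]") auto

lemma block_list_simps [simp]:
  "block_list []"
  "block_list (ds # bs) \<longleftrightarrow> ds \<noteq> [] \<and> sorted_wrt (>) ds \<and> 0 \<notin> set ds \<and> block_list bs"
  by (auto simp: block_list_def)

section \<open>Block walks are distinct valid walks\<close>

lemma block_walk_nonempty:
  assumes "block_list bs"
  shows "block_walk k bs \<noteq> []"
    and "hd (block_walk k bs) = (k, if bs = [] then 0 else hd (hd bs))"
  using assms by (induction k bs rule: block_walk.induct) auto

text \<open>Passing from \<open>(0, d)\<close> to \<open>(0, e)\<close> within a block takes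
  \<open>d - e\<close> beats, and the last distance \<open>d\<close> of a block takes
  \<open>d\<close> beats. Over a block this telescopes to its maximum.\<close>

lemma length_block_walk:
  "block_list bs \<Longrightarrow> length (block_walk k bs) = Suc k + sum_list (map hd bs)"
  by (induction k bs rule: block_walk.induct) auto

lemma last_block_walk: "block_list bs \<Longrightarrow> last (block_walk k bs) = (0, 0)"
  by (induction k bs rule: block_walk.induct) (auto simp: block_walk_nonempty)

lemma successively_block_walk:
  "block_list bs \<Longrightarrow> successively pair_step (block_walk k bs)"
proof (induction k bs rule: block_walk.induct)
  case (4 d bs)
  then show ?case
    by (cases d) (auto simp: successively_Cons block_walk_nonempty)
next
  case (5 d e ds bs)
  then show ?case
    by (cases d) (auto simp: successively_Cons block_walk_nonempty)
qed (auto simp: successively_Cons block_walk_nonempty)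

text \<open>The distances can be read off at the states with lowest position 0, one such state per
  distance. Hence a distinct walk has distinct distances.\<close>

lemma map_snd_filter_block_walk:
  "block_list bs \<Longrightarrow> map snd (filter (\<lambda>x. fst x = 0) (block_walk k bs)) = concat bs @ [0]"
  by (induction k bs rule: block_walk.induct) auto

lemma distance_block_walk:
  "block_list bs \<Longrightarrow> x \<in> set (block_walk k bs) \<Longrightarrow> snd x \<in> set (concat bs) \<or> snd x = 0"
proof (induction k bs rule: block_walk.induct)
  case (1 k bs)
  then show ?case by (cases bs) auto
qed auto

text \<open>With distinct distances, the initial distance is never resumed once it is left, so it
  only occurs during the descent from \<open>k\<close>. This separates a state prepended at
  \<open>Suc k\<close> from the later ones.\<close>

lemma position_block_walk:
  "block_list bs \<Longrightarrow> distinct (concat bs) \<Longrightarrow> x \<in> set (block_walk k bs) \<Longrightarrow>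
    snd x = (if bs = [] then 0 else hd (hd bs)) \<Longrightarrow> fst x \<le> k"
proof (induction k bs rule: block_walk.induct)
  case (4 d bs)
  then show ?case
    using distance_block_walk[of bs x "d - 1"] by (cases x) auto
next
  case (5 d e ds bs)
  then show ?case
    using distance_block_walk[of "(e # ds) # bs" x "d - 1 - e"] by (cases x) auto
qed (auto simp del: block_list_simps(2))

lemma distinct_block_walk:
  "block_list bs \<Longrightarrow> distinct (concat bs) \<Longrightarrow> distinct (block_walk k bs)"
proof (induction k bs rule: block_walk.induct)
  case (1 k bs)
  then show ?case
    using position_block_walk[of bs _ k] by fastforce
next
  case (4 d bs)
  then show ?case
    using distance_block_walk[of bs "(0, d)" "d - 1"] by auto
next
  case (5 d e ds bs)
  then show ?case
    using distance_block_walk[of "(e # ds) # bs" "(0, d)" "d - 1 - e"] by auto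
qed auto

section \<open>Recovering the blocks from a walk\<close>

text \<open>The first state shows the position and the first distance. After \<open>(0, d)\<close>
  the next lowest position is \<open>d - 1\<close> if the block ends and \<open>d - 1 - e\<close>
  with \<open>0 < e < d\<close> if it goes on, so the two cases cannot be confused.\<close>

lemma block_walk_inject:
  "block_list bs \<Longrightarrow> block_list cs \<Longrightarrow> block_walk k bs = block_walk l cs \<Longrightarrow> k = l \<and> bs = cs"
proof (induction k bs arbitrary: l cs rule: block_walk.induct)
  case (1 k bs)
  then have "l = Suc k"
    using block_walk_nonempty(2)[of cs l] block_walk_nonempty(2)[of bs "Suc k"] by simp
  then show ?case
    using 1 by auto
next
  case 2
  then show ?case
    using block_walk_nonempty(2)[of cs l] by (cases "(l, cs)" rule: block_walk.cases) auto
next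
  case (3 bs)
  then show ?case by simp
next
  case (4 d bs)
  show ?case
  proof (cases "(l, cs)" rule: block_walk.cases)
    case c: (5 d' e ds cs')
    have "block_walk (d - 1) bs = block_walk (d - 1 - e) ((e # ds) # cs')"
      using 4 c by auto
    then have "d - 1 = d - 1 - e"
      using 4 c by (intro "4.IH"[THEN conjunct1, of "(e # ds) # cs'"]) auto
    then show ?thesis using 4 c by auto
  qed (use 4 in auto)
next
  case (5 d e ds bs)
  show ?case
  proof (cases "(l, cs)" rule: block_walk.cases)
    case c: (4 d' cs')
    have "block_walk (d - 1 - e) ((e # ds) # bs) = block_walk (d - 1) cs'"
      using 5 c by auto
    then have "d - 1 - e = d - 1"
      using 5 c by (intro "5.IH"[THEN conjunct1, of cs']) auto
    then show ?thesis using 5 c by auto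
  next
    case c: (5 d' e' ds' cs')
    have "block_walk (d - 1 - e) ((e # ds) # bs) = block_walk (d - 1 - e') ((e' # ds') # cs')"
      using 5 c by auto
    then have "(e # ds) # bs = (e' # ds') # cs'"
      using 5 c by (intro "5.IH"[THEN conjunct2]) auto
    then show ?thesis using 5 c by auto
  qed (use 5 in auto)
qed

text \<open>The blocks are built from the end of the walk. A state prepended to a walk prolongs the
  initial descent, opens a new block or extends the first block. Distinctness excludes a second
  \<open>(0, 0)\<close>.\<close>

lemma block_walk_exhaust:
  assumes "successively pair_step v" "v \<noteq> []" "last v = (0, 0)" "distinct v"
  obtains k bs where "block_list bs" "v = block_walk k bs"
proof -
  from assms have "\<exists>k bs. block_list bs \<and> v = block_walk k bs"
  proof (induction v)
    case (Cons x v)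
    show ?case
    proof (cases "v = []")
      case True
      then show ?thesis using Cons.prems by (intro exI[of _ 0] exI[of _ "[]"]) auto
    next
      case False
      then obtain k bs where bs: "block_list bs" and v: "v = block_walk k bs"
        using Cons by (auto simp: successively_Cons)
      define e where "e = (if bs = [] then 0 else hd (hd bs))"
      have "hd v = (k, e)"
        using block_walk_nonempty[OF bs] by (simp add: v e_def)
      then have step: "pair_step x (k, e)"
        using Cons.prems False by (simp add: successively_Cons)
      have "(0, 0) \<in> set v"
        using Cons.prems False last_in_set[of v] by auto
      then have "x \<noteq> (0, 0)" using Cons.prems by auto
      show ?thesis
      proof (cases x rule: prod.exhaust)
        case x: (Pair l d)
        show ?thesis
        proof (cases l)
          case (Suc l')
          then have "x # v = block_walk (Suc k) bs"
            using step x by (auto simp: v e_def)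
          then show ?thesis using bs by blast
        next
          case 0
          then have "d > 0" using \<open>x \<noteq> (0, 0)\<close> x by auto
          then have ke: "k = d - 1 \<or> k + e = d - 1"
            using step x 0 by (cases d) auto
          \<comment> \<open>For \<open>k = d - 1\<close> a new block \<open>[d]\<close> is opened,
            also when \<open>e = 0\<close>. Otherwise \<open>0 < e < d\<close>, and \<open>d\<close>
            is put in front of the first block.\<close>
          show ?thesis
          proof (cases "k = d - 1")
            case True
            then show ?thesis
              using x 0 v bs \<open>d > 0\<close> by (intro exI[of _ 0] exI[of _ "[d] # bs"]) auto
          next
            case False
            then have "e > 0" "k = d - 1 - e" "e < d" using ke by auto
            moreover obtain ds cs where "bs = (e # ds) # cs"
              using \<open>e > 0\<close> bs unfolding e_def by (cases bs; cases "hd bs") auto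
            ultimately show ?thesis
              using x 0 v bs \<open>d > 0\<close>
              by (intro exI[of _ 0] exI[of _ "(d # e # ds) # cs"]) auto
          qed
        qed
      qed
    qed
  qed simp
  then show thesis using that by blast
qed

lemma distinct_concat_if_distinct_block_walk:
  assumes "block_list bs" "distinct (block_walk k bs)"
  shows "distinct (concat bs)"
proof -
  have "distinct (map snd (filter (\<lambda>x. fst x = 0) (block_walk k bs)))"
    using assms by (auto simp: distinct_map inj_on_def)
  then show ?thesis
    using assms by (simp add: map_snd_filter_block_walk)
qed

text \<open>By the length formula a walk of length \<open>n\<close> with block maxima summing to
  \<open>m\<close> starts at position \<open>n - 1 - m\<close>.\<close>

lemma bij_betw_block_walk:
  assumes "n \<ge> 1"
  shows "bij_betw (\<lambda>(m, bs). block_walk (n - 1 - m) bs)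
    (SIGMA m:{0..n - 1}. disjoint_block_lists m) (cut_walks n)"
proof (rule bij_betw_imageI)
  show "inj_on (\<lambda>(m, bs). block_walk (n - 1 - m) bs) (SIGMA m:{0..n - 1}. disjoint_block_lists m)"
    by (rule inj_onI) (auto simp: disjoint_block_lists_def dest: block_walk_inject)
  show "(\<lambda>(m, bs). block_walk (n - 1 - m) bs) ` (SIGMA m:{0..n - 1}. disjoint_block_lists m)
    = cut_walks n"
  proof (intro subset_antisym subsetI)
    fix v assume "v \<in> (\<lambda>(m, bs). block_walk (n - 1 - m) bs) `
      (SIGMA m:{0..n - 1}. disjoint_block_lists m)"
    then show "v \<in> cut_walks n"
      using assms
      by (auto simp: cut_walks_def disjoint_block_lists_def length_block_walk distinct_block_walk
          successively_block_walk block_walk_nonempty last_block_walk)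
  next
    fix v assume v: "v \<in> cut_walks n"
    then obtain k bs where bs: "block_list bs" "v = block_walk k bs"
      by (auto simp: cut_walks_def elim: block_walk_exhaust)
    define m where "m = sum_list (map hd bs)"
    have "n = Suc k + m"
      using v bs by (auto simp: cut_walks_def length_block_walk m_def)
    moreover have "distinct (concat bs)"
      using v bs distinct_concat_if_distinct_block_walk by (auto simp: cut_walks_def)
    ultimately show "v \<in> (\<lambda>(m, bs). block_walk (n - 1 - m) bs) `
      (SIGMA m:{0..n - 1}. disjoint_block_lists m)"
      using bs by (intro image_eqI[of _ _ "(m, bs)"]) (auto simp: disjoint_block_lists_def m_def)
  qed
qed

section \<open>Counting block lists\<close>

text \<open>These are the possible lists of block maxima, in the order of the blocks.\<close>

definition distinct_compositions :: "nat \<Rightarrow> nat list set" where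
  "distinct_compositions m = {ps. distinct ps \<and> 0 \<notin> set ps \<and> sum_list ps = m}"

text \<open>
  \<open>owners P j\<close> are the maxima of the blocks that may contain \<open>j\<close> when \<open>P\<close> is the set of all
  maxima; \<open>0\<close> stands for no block.
\<close>

definition owners :: "nat set \<Rightarrow> nat \<Rightarrow> nat set" where
  "owners P j = (if j \<in> P then {j} else insert 0 {p\<in>P. j < p})"

text \<open>The block with maximum \<open>p\<close> is the fibre of \<open>g\<close> over
  \<open>p\<close>, in decreasing order; numbers with value 0 are dropped. All entries are at most
  \<open>m\<close> because the maxima sum to \<open>m\<close>.\<close>

definition blocks_of :: "nat \<Rightarrow> nat list \<Rightarrow> (nat \<Rightarrow> nat) \<Rightarrow> nat list list" where
  "blocks_of m ps g = map (\<lambda>p. filter (\<lambda>j. g j = p) (rev [1..<Suc m])) ps"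

text \<open>The number of ways to assign an owner to every number up to \<open>m\<close>.\<close>

definition weight :: "nat \<Rightarrow> nat set \<Rightarrow> nat" where
  "weight m P = (\<Prod>j\<in>{1..m}. card (owners P j))"

lemma hd_sorted_wrt_greater:
  fixes xs :: "nat list"
  assumes "sorted_wrt (>) xs" "p \<in> set xs" "\<And>x. x \<in> set xs \<Longrightarrow> x \<le> p"
  shows "hd xs = p"
  using assms by (cases xs) force+

lemma le_hd_sorted_wrt_greater:
  fixes xs :: "nat list"
  assumes "sorted_wrt (>) xs" "x \<in> set xs"
  shows "x \<le> hd xs"
  using assms by (cases xs) auto

lemma sorted_wrt_greater_unique:
  fixes xs ys :: "nat list"
  assumes "sorted_wrt (>) xs" "sorted_wrt (>) ys" "set xs = set ys"
  shows "xs = ys"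
  using strict_sorted_equal[of "rev xs" "rev ys"] assms by (simp add: sorted_wrt_rev)

lemma sorted_wrt_greater_filter: "sorted_wrt (>) (filter Q (rev [1..<Suc m]))"
  by (intro sorted_wrt_filter) (simp add: sorted_wrt_rev del: upt_Suc)

context
  fixes m :: nat and ps g
  assumes ps: "ps \<in> distinct_compositions m"
    and g: "g \<in> (\<Pi>\<^sub>E j\<in>{1..m}. owners (set ps) j)"
begin

lemma composition_part_bounds: "p \<in> set ps \<Longrightarrow> 1 \<le> p \<and> p \<le> m"
  using ps member_le_sum_list[of p ps] by (cases p) (auto simp: distinct_compositions_def)

text \<open>A maximum can only be owned by itself, and every other number that it owns is
  smaller.\<close>

lemma hd_blocks_of:
  assumes "p \<in> set ps"
  shows "p \<in> set (filter (\<lambda>j. g j = p) (rev [1..<Suc m]))"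
    and "hd (filter (\<lambda>j. g j = p) (rev [1..<Suc m])) = p"
proof -
  have "g p \<in> owners (set ps) p"
    using g composition_part_bounds[OF assms] by auto
  then have "g p = p" using assms by (simp add: owners_def)
  then show *: "p \<in> set (filter (\<lambda>j. g j = p) (rev [1..<Suc m]))"
    using composition_part_bounds[OF assms] by (auto simp del: upt_Suc)
  have "j \<le> p" if "j \<in> set (filter (\<lambda>j. g j = p) (rev [1..<Suc m]))" for j
  proof -
    have "g j = p" "g j \<in> owners (set ps) j"
      using that g by (auto simp del: upt_Suc)
    then show ?thesis
      using composition_part_bounds[OF assms] by (auto simp: owners_def split: if_splits)
  qed
  then show "hd (filter (\<lambda>j. g j = p) (rev [1..<Suc m])) = p"
    using * by (intro hd_sorted_wrt_greater sorted_wrt_greater_filter)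
qed

lemma map_hd_blocks_of: "map hd (blocks_of m ps g) = ps"
  using hd_blocks_of by (auto simp: blocks_of_def comp_def simp del: upt_Suc intro!: map_idI)

lemma blocks_of_disjoint_block_lists: "blocks_of m ps g \<in> disjoint_block_lists m"
proof -
  have "distinct qs \<Longrightarrow>
    distinct (concat (map (\<lambda>p. filter (\<lambda>j. g j = p) (rev [1..<Suc m])) qs))" for qs
    by (induction qs) (auto simp del: upt_Suc)
  then have "distinct (concat (blocks_of m ps g))"
    using ps by (simp add: blocks_of_def distinct_compositions_def del: upt_Suc)
  moreover have "block_list (blocks_of m ps g)"
    unfolding block_list_def
  proof
    fix ds assume "ds \<in> set (blocks_of m ps g)"
    then obtain p where p: "p \<in> set ps" and ds: "ds = filter (\<lambda>j. g j = p) (rev [1..<Suc m])"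
      by (auto simp: blocks_of_def simp del: upt_Suc)
    have "p \<in> set ds" using hd_blocks_of(1)[OF p] by (simp only: ds)
    moreover have "sorted_wrt (>) ds" unfolding ds by (rule sorted_wrt_greater_filter)
    moreover have "0 \<notin> set ds" by (simp add: ds del: upt_Suc)
    ultimately show "ds \<noteq> [] \<and> sorted_wrt (>) ds \<and> 0 \<notin> set ds" by auto
  qed
  ultimately show ?thesis
    using ps map_hd_blocks_of by (simp add: disjoint_block_lists_def distinct_compositions_def)
qed

end

text \<open>The inverse takes a block list to the list of its heads and to the map sending each
  number to the head of its block, or to 0 outside all blocks.\<close>

lemma bij_betw_blocks_of:
  "bij_betw (\<lambda>(ps, g). blocks_of m ps g)
    (SIGMA ps:distinct_compositions m. \<Pi>\<^sub>E j\<in>{1..m}. owners (set ps) j) (disjoint_block_lists m)"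
  (is "bij_betw ?f ?A _")
proof (rule bij_betw_imageI)
  show "inj_on ?f ?A"
  proof (rule inj_onI, clarify)
    fix ps g qs h
    assume ps: "ps \<in> distinct_compositions m" and g: "g \<in> (\<Pi>\<^sub>E j\<in>{1..m}. owners (set ps) j)"
      and qs: "qs \<in> distinct_compositions m" and h: "h \<in> (\<Pi>\<^sub>E j\<in>{1..m}. owners (set qs) j)"
      and eq: "blocks_of m ps g = blocks_of m qs h"
    have "ps = qs"
      using map_hd_blocks_of[OF ps g] map_hd_blocks_of[OF qs h] eq by simp
    have same: "g j = p \<longleftrightarrow> h j = p" if "j \<in> {1..m}" "p \<in> set ps" for j p
    proof -
      have "filter (\<lambda>j. g j = p) (rev [1..<Suc m]) = filter (\<lambda>j. h j = p) (rev [1..<Suc m])"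
        using eq that \<open>ps = qs\<close> by (simp add: blocks_of_def del: upt_Suc)
      then have "j \<in> set (filter (\<lambda>j. g j = p) (rev [1..<Suc m])) \<longleftrightarrow>
          j \<in> set (filter (\<lambda>j. h j = p) (rev [1..<Suc m]))" by (simp only:)
      then show ?thesis using that(1) by (simp add: less_Suc_eq_le del: upt_Suc)
    qed
    \<comment> \<open>Values in \<open>set ps\<close> agree by \<open>same\<close>; if neither value
      lies there, both are 0.\<close>
    have eq_on: "g j = h j" if j: "j \<in> {1..m}" for j
    proof -
      have "g j \<in> insert 0 (set ps)" "h j \<in> insert 0 (set ps)"
        using PiE_mem[OF g j] PiE_mem[OF h j] \<open>ps = qs\<close>
        by (auto simp: owners_def split: if_splits)
      then show ?thesis using same[OF j, of "g j"] same[OF j, of "h j"] by auto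
    qed
    have "g = h"
      by (rule PiE_ext[OF g]) (use h \<open>ps = qs\<close> eq_on in simp_all)
    then show "ps = qs \<and> g = h"
      using \<open>ps = qs\<close> by simp
  qed
  have "bs \<in> ?f ` ?A" if bs: "bs \<in> disjoint_block_lists m" for bs
  proof -
    define ps where "ps = map hd bs"
    define g where "g = (\<lambda>j\<in>{1..m}. if \<exists>ds\<in>set bs. j \<in> set ds
      then hd (SOME ds. ds \<in> set bs \<and> j \<in> set ds) else 0)"
    have ne: "ds \<noteq> []" "sorted_wrt (>) ds" "0 \<notin> set ds" "hd ds \<in> set ds" if "ds \<in> set bs" for ds
      using bs that by (auto simp: disjoint_block_lists_def block_list_def)
    \<comment> \<open>Distinctness of the concatenation does not see repeated empty blocks; without
      them the blocks themselves are distinct.\<close>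
    have "[] \<notin> set bs" using ne(1) by blast
    have dist: "distinct bs"
      and disj: "\<And>ds es. ds \<in> set bs \<Longrightarrow> es \<in> set bs \<Longrightarrow> ds \<noteq> es \<Longrightarrow> set ds \<inter> set es = {}"
      using bs \<open>[] \<notin> set bs\<close> by (auto simp: disjoint_block_lists_def distinct_concat_iff)
    have bound: "1 \<le> j \<and> j \<le> hd ds \<and> j \<le> m" if "ds \<in> set bs" "j \<in> set ds" for ds j
    proof -
      have "j \<le> hd ds" using le_hd_sorted_wrt_greater ne that by blast
      moreover have "hd ds \<le> m"
        using member_le_sum_list[of "hd ds" "map hd bs"] bs that
        by (auto simp: disjoint_block_lists_def)
      moreover have "j \<noteq> 0" using ne(3) that by metis
      ultimately show ?thesis by simp
    qed
    have g_in: "g j = hd ds" if ds: "ds \<in> set bs" "j \<in> set ds" for ds j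
    proof -
      have "(SOME ds. ds \<in> set bs \<and> j \<in> set ds) = ds"
        using ds disj by (intro some_equality) auto
      then show ?thesis using ds bound[OF ds] by (auto simp: g_def)
    qed
    have g_iff: "g j = hd ds \<longleftrightarrow> j \<in> set ds" if ds: "ds \<in> set bs" and j: "j \<in> {1..m}" for ds j
    proof
      assume eq: "g j = hd ds"
      have "hd ds \<noteq> 0" using ne[OF ds] by metis
      then obtain es where es: "es \<in> set bs" "j \<in> set es"
        using eq j by (auto simp: g_def split: if_splits)
      then have "hd es = hd ds" using g_in eq by simp
      then have "es = ds" using disj[of es ds] es ds ne(4) by (metis disjoint_iff)
      then show "j \<in> set ds" using es by simp
    qed (rule g_in[OF ds])
    have "distinct ps"
      using dist disj ne(4) unfolding ps_def distinct_map inj_on_def by (metis disjoint_iff)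
    moreover have "0 \<notin> set ps"
      using ne(3,4) by (force simp: ps_def)
    ultimately have "ps \<in> distinct_compositions m"
      using bs by (simp add: distinct_compositions_def disjoint_block_lists_def ps_def)
    moreover have "g \<in> (\<Pi>\<^sub>E j\<in>{1..m}. owners (set ps) j)"
    proof (rule PiE_I)
      fix j assume j: "j \<in> {1..m}"
      show "g j \<in> owners (set ps) j"
      proof (cases "\<exists>ds\<in>set bs. j \<in> set ds")
        case True
        then obtain ds where ds: "ds \<in> set bs" "j \<in> set ds" by blast
        have "j = hd ds" if "j \<in> set ps"
        proof -
          obtain es where "es \<in> set bs" "j = hd es" using \<open>j \<in> set ps\<close> by (auto simp: ps_def)
          then show ?thesis using ds disj[of ds es] ne(4)[of es] by blast
        qed
        then show ?thesis
          using g_in[OF ds] bound[OF ds] ds by (auto simp: owners_def ps_def)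
      next
        case False
        then have "g j = 0" "j \<notin> set ps"
          using j ne(4) by (auto simp: g_def ps_def)
        then show ?thesis by (simp add: owners_def)
      qed
    qed (auto simp: g_def)
    moreover have "blocks_of m ps g = bs"
    proof -
      have "filter (\<lambda>j. g j = hd ds) (rev [1..<Suc m]) = ds" if ds: "ds \<in> set bs" for ds
      proof (rule sorted_wrt_greater_unique[OF sorted_wrt_greater_filter ne(2)[OF ds]])
        have "{j \<in> {1..m}. g j = hd ds} = set ds"
        proof (rule set_eqI)
          fix j
          have "j \<in> set ds \<Longrightarrow> j \<in> {1..m}" using bound[OF ds, of j] by simp
          then show "j \<in> {j \<in> {1..m}. g j = hd ds} \<longleftrightarrow> j \<in> set ds"
            using g_iff[OF ds, of j] by blast
        qed
        moreover have "set (filter (\<lambda>j. g j = hd ds) (rev [1..<Suc m])) = {j \<in> {1..m}. g j = hd ds}"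
          by (simp add: atLeastLessThanSuc_atLeastAtMost del: upt_Suc)
        ultimately show "set (filter (\<lambda>j. g j = hd ds) (rev [1..<Suc m])) = set ds" by simp
      qed
      then have "map (\<lambda>ds. filter (\<lambda>j. g j = hd ds) (rev [1..<Suc m])) bs = bs"
        by (rule map_idI)
      then show ?thesis
        by (simp add: blocks_of_def ps_def comp_def del: upt_Suc)
    qed
    ultimately show ?thesis
      by (intro image_eqI[of _ _ "(ps, g)"] SigmaI) simp_all
  qed
  moreover have "?f x \<in> disjoint_block_lists m" if "x \<in> ?A" for x
    using that blocks_of_disjoint_block_lists by (cases x) auto
  ultimately show "?f ` ?A = disjoint_block_lists m"
    by blast
qed

section \<open>Grouping the orders of the maxima\<close>

lemma finite_distinct_compositions: "finite (distinct_compositions m)"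
proof (rule finite_subset)
  show "distinct_compositions m \<subseteq> {ps. set ps \<subseteq> {..m} \<and> distinct ps}"
    by (auto simp: distinct_compositions_def member_le_sum_list)
qed (simp add: finite_subset_distinct)

lemma finite_owners: "finite P \<Longrightarrow> finite (owners P j)"
  by (simp add: owners_def)

lemma finite_disjoint_block_lists: "finite (disjoint_block_lists m)"
  and card_disjoint_block_lists:
    "card (disjoint_block_lists m) = (\<Sum>ps\<in>distinct_compositions m. weight m (set ps))"
proof -
  let ?B = "\<lambda>ps. \<Pi>\<^sub>E j\<in>{1..m}. owners (set ps) j"
  have fin: "finite (?B ps)" for ps
    by (intro finite_PiE) (simp_all add: finite_owners)
  then show "finite (disjoint_block_lists m)"
    using bij_betw_finite[OF bij_betw_blocks_of] finite_distinct_compositions by blast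
  show "card (disjoint_block_lists m) = (\<Sum>ps\<in>distinct_compositions m. weight m (set ps))"
    using fin finite_distinct_compositions bij_betw_same_card[OF bij_betw_blocks_of, of m]
    by (simp add: card_SigmaI card_PiE weight_def)
qed

text \<open>The weight depends only on the set of maxima. Compositions are grouped by their
  decreasing rearrangement, and a partition into \<open>t\<close> distinct parts has
  \<open>fact t\<close> orders.\<close>

lemma sum_distinct_compositions:
  "(\<Sum>ps\<in>distinct_compositions m. weight m (set ps)) =
    (\<Sum>t\<in>{0..m}. \<Sum>p\<in>distinct_partitions t m. fact t * weight m (set p))"
proof -
  define desc :: "nat list \<Rightarrow> nat list" where "desc ps = rev (sorted_list_of_set (set ps))" for ps
  define T where "T = (\<Union>t\<in>{0..m}. distinct_partitions t m)"
  have desc: "sorted_wrt (>) (desc ps)" "set (desc ps) = set ps" for ps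
    by (simp_all add: desc_def sorted_wrt_rev)
  have dist: "distinct p" if "sorted_wrt (>) p" for p :: "nat list"
    using that by (induction p) auto
  have sub: "desc ` distinct_compositions m \<subseteq> T"
  proof
    fix p assume "p \<in> desc ` distinct_compositions m"
    then obtain ps where ps: "distinct ps" "0 \<notin> set ps" "sum_list ps = m" and p: "p = desc ps"
      by (auto simp: distinct_compositions_def)
    have "sum_list p = m"
      using ps dist[OF desc(1)[of ps]] by (simp add: p desc distinct_sum_list_conv_Sum)
    moreover have "\<forall>x\<in>set p. x \<ge> 1"
      using ps by (auto simp: p desc Suc_le_eq intro!: gr0I)
    ultimately have "p \<in> distinct_partitions (length p) m" "length p \<le> m"
      using length_le_sum_list[of p] desc(1)[of ps] by (auto simp: p distinct_partitions_def)
    then show "p \<in> T" by (auto simp: T_def)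
  qed
  have fiber: "{ps \<in> distinct_compositions m. desc ps = p} = permutations_of_set (set p)"
    if p: "p \<in> T" for p
  proof -
    have sp: "sorted_wrt (>) p" "\<forall>x\<in>set p. x \<ge> 1" "sum_list p = m"
      using p by (auto simp: T_def distinct_partitions_def)
    have "desc ps = p \<longleftrightarrow> set ps = set p" for ps
      using sorted_wrt_greater_unique[OF desc(1) sp(1)] desc(2) by metis
    moreover have "0 \<notin> set p" using sp(2) by force
    moreover have "sum_list ps = m" if "set ps = set p" "distinct ps" for ps
      using that sp(3) dist[OF sp(1)] by (metis distinct_sum_list_conv_Sum)
    ultimately show ?thesis
      by (auto simp: permutations_of_set_def distinct_compositions_def)
  qed
  have finT: "finite T" by (simp add: T_def finite_distinct_partitions)
  have "(\<Sum>ps\<in>distinct_compositions m. weight m (set ps)) =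
      (\<Sum>p\<in>T. \<Sum>ps\<in>{ps \<in> distinct_compositions m. desc ps = p}. weight m (set ps))"
    by (rule sum.group[OF finite_distinct_compositions finT sub, symmetric])
  also have "\<dots> = (\<Sum>p\<in>T. fact (length p) * weight m (set p))"
  proof (rule sum.cong[OF refl])
    fix p assume p: "p \<in> T"
    then have "card (set p) = length p"
      using dist by (intro distinct_card) (auto simp: T_def distinct_partitions_def)
    moreover have "(\<Sum>ps\<in>permutations_of_set (set p). weight m (set ps)) =
        (\<Sum>ps\<in>permutations_of_set (set p). weight m (set p))"
      by (intro sum.cong) (auto simp: permutations_of_set_def)
    ultimately show "(\<Sum>ps\<in>{ps \<in> distinct_compositions m. desc ps = p}. weight m (set ps)) =
        fact (length p) * weight m (set p)"
      by (simp add: fiber[OF p])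
  qed
  also have "\<dots> = (\<Sum>t\<in>{0..m}. \<Sum>p\<in>distinct_partitions t m. fact (length p) * weight m (set p))"
    unfolding T_def
  proof (intro sum.UNION_disjoint ballI impI)
    show "distinct_partitions s m \<inter> distinct_partitions t m = {}" if "s \<noteq> t" for s t
      using that by (auto simp: distinct_partitions_def)
  qed (simp_all add: finite_distinct_partitions)
  also have "\<dots> = (\<Sum>t\<in>{0..m}. \<Sum>p\<in>distinct_partitions t m. fact t * weight m (set p))"
    by (intro sum.cong refl) (auto simp: distinct_partitions_def)
  finally show ?thesis .
qed

section \<open>Closed form of the weight\<close>

text \<open>A new smallest maximum \<open>x\<close> gives each \<open>j < x\<close> one more owner,
  reduces the owners of \<open>x\<close> from \<open>card P + 1\<close> to 1 and changes nothing
  above \<open>x\<close>. The product form avoids division in the naturals.\<close>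

lemma weight_insert:
  assumes "finite P" "1 \<le> x" "x \<le> m" "\<And>p. p \<in> P \<Longrightarrow> x < p"
  shows "weight m (insert x P) * (card P + 1) ^ x = weight m P * (card P + 2) ^ (x - 1)"
proof -
  define R where "R = (\<Prod>j\<in>{x<..m}. card (owners P j))"
  have split: "weight m Q =
      (\<Prod>j\<in>{1..<x}. card (owners Q j)) * (card (owners Q x) * (\<Prod>j\<in>{x<..m}. card (owners Q j)))" for Q
  proof -
    have *: "{1..m} = {1..<x} \<union> insert x {x<..m}" using assms by auto
    show ?thesis
      unfolding weight_def * by (subst prod.union_disjoint) auto
  qed
  have low: "card (owners P j) = card P + 1" if "j \<le> x" for j
  proof -
    have "owners P j = insert 0 P" "0 \<notin> P"
      using that assms(4) by (force simp: owners_def)+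
    then show ?thesis using assms(1) by simp
  qed
  have low': "card (owners (insert x P) j) = card P + 2" if "j < x" for j
  proof -
    have "owners (insert x P) j = insert 0 (insert x P)" "0 \<notin> insert x P" "x \<notin> P"
      using that assms(2,4) by (force simp: owners_def)+
    then show ?thesis using assms(1) by simp
  qed
  have high: "owners (insert x P) j = owners P j" if "x < j" for j
    using that by (auto simp: owners_def)
  \<comment> \<open>The factor at \<open>x\<close> joins the \<open>x - 1\<close> equal factors
    below it.\<close>
  have "weight m P = (card P + 1) ^ x * R"
    using assms(2) power_minus_mult[of x "card P + 1", symmetric]
    by (simp add: split low R_def algebra_simps)
  moreover have "weight m (insert x P) = (card P + 2) ^ (x - 1) * R"
    using high low' by (simp add: split R_def owners_def[of _ x])
  ultimately show ?thesis by simp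
qed

text \<open>Parts are appended in decreasing order, so each new one is the smallest and
  \<open>weight_insert\<close> applies. Since \<open>m\<close> is only an upper bound for the parts,
  the induction hypothesis covers the shorter list with the same \<open>m\<close>.\<close>

lemma weight_distinct_partition:
  assumes "sorted_wrt (>) p" "\<And>x. x \<in> set p \<Longrightarrow> 1 \<le> x \<and> x \<le> m"
  shows "fact (length p) * real (weight m (set p)) =
    1 / (real (length p) + 1) * (\<Prod>i=1..length p. ((real i + 1) / real i) ^ (p ! (i - 1)))"
  using assms
proof (induction p rule: rev_induct)
  case Nil
  then show ?case by (simp add: weight_def owners_def)
next
  case (snoc x p)
  define t where "t = length p"
  define X where "X = (\<Prod>i=1..t. ((real i + 1) / real i) ^ (p ! (i - 1)))"
  have sorted: "sorted_wrt (>) p" and less: "\<And>y. y \<in> set p \<Longrightarrow> x < y"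
    using snoc.prems(1) by (auto simp: sorted_wrt_append)
  have x: "1 \<le> x" "x \<le> m" using snoc.prems(2) by auto
  have "distinct p" using sorted by (induction p) auto
  then have card: "card (set p) = t" by (simp add: t_def distinct_card)
  have IH: "fact t * real (weight m (set p)) = 1 / (real t + 1) * X"
    using snoc.IH[OF sorted] snoc.prems(2) by (simp add: t_def X_def)
  have "real (weight m (insert x (set p)) * (t + 1) ^ x) = real (weight m (set p) * (t + 2) ^ (x - 1))"
    using weight_insert[of "set p", OF _ x less] card by simp
  then have "real (weight m (insert x (set p))) =
      real (weight m (set p)) * (real t + 2) ^ (x - 1) / (real t + 1) ^ x"
    by (simp add: field_simps)
  then have "fact (Suc t) * real (weight m (insert x (set p))) =
      (real t + 1) * (fact t * real (weight m (set p))) * (real t + 2) ^ (x - 1) / (real t + 1) ^ x"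
    by (simp add: field_simps)
  \<comment> \<open>The new factorial factor \<open>t + 1\<close> cancels the denominator from the
    induction hypothesis.\<close>
  also have "\<dots> = X * (real t + 2) ^ (x - 1) / (real t + 1) ^ x"
    by (simp add: IH)
  also have "\<dots> = 1 / (real t + 2) * (X * ((real t + 2) / (real t + 1)) ^ x)"
  proof -
    have "X * b ^ (x - 1) / a ^ x = 1 / b * (X * (b / a) ^ x)" if "b > 0" for a b :: real
      using x(1) that by (cases x) (simp_all add: power_divide)
    then show ?thesis by simp
  qed
  also have "X * ((real t + 2) / (real t + 1)) ^ x =
      (\<Prod>i=1..Suc t. ((real i + 1) / real i) ^ ((p @ [x]) ! (i - 1)))"
  proof -
    have "(\<Prod>i=1..t. ((real i + 1) / real i) ^ ((p @ [x]) ! (i - 1))) = X"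
      unfolding X_def by (intro prod.cong) (auto simp: nth_append t_def)
    then show ?thesis by (simp add: nth_append t_def add_ac)
  qed
  finally show ?case by (simp add: t_def add_ac)
qed

section \<open>Assembling the formula\<close>

text \<open>The factor \<open>t\<close> turns \<open>1 / (t (t + 1))\<close> in \<open>c\<close>
  into the \<open>1 / (t + 1)\<close> of the weight formula. The term \<open>t = 0\<close> vanishes
  as \<open>m\<close> is positive.\<close>

lemma card_disjoint_block_lists_eq_c:
  assumes "m \<ge> 1"
  shows "real (card (disjoint_block_lists m)) = (\<Sum>t\<in>{1..m}. real t * c t m)"
proof -
  have "real (card (disjoint_block_lists m)) =
      (\<Sum>t\<in>{0..m}. \<Sum>p\<in>distinct_partitions t m. fact t * real (weight m (set p)))"
    by (simp add: card_disjoint_block_lists sum_distinct_compositions)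
  also have "\<dots> = (\<Sum>t\<in>{1..m}. \<Sum>p\<in>distinct_partitions t m. fact t * real (weight m (set p)))"
    using assms by (intro sum.mono_neutral_right) (auto simp: distinct_partitions_def not_less_eq_eq)
  also have "\<dots> = (\<Sum>t\<in>{1..m}. real t * c t m)"
  proof (intro sum.cong refl)
    fix t assume "t \<in> {1..m}"
    then show "(\<Sum>p\<in>distinct_partitions t m. fact t * real (weight m (set p))) = real t * c t m"
      unfolding c_def sum_distrib_left
    proof (intro sum.cong refl)
      fix p assume p: "p \<in> distinct_partitions t m"
      then have "sorted_wrt (>) p" "\<And>x. x \<in> set p \<Longrightarrow> 1 \<le> x \<and> x \<le> m"
        using member_le_sum_list[of _ p] by (auto simp: distinct_partitions_def)
      then show "fact t * real (weight m (set p)) = real t * (1 / (real t * (real t + 1)) *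
          (\<Prod>i=1..t. ((real i + 1) / real i) ^ (p ! (i - 1))))"
        using weight_distinct_partition[of p m] p \<open>t \<in> {1..m}\<close>
        by (simp add: distinct_partitions_def)
    qed
  qed
  finally show ?thesis .
qed

text \<open>The empty list encodes the plain descent from \<open>(n - 1, 0)\<close> to
  \<open>(0, 0)\<close>; it accounts for the summand 1 of the theorem.\<close>

lemma card_disjoint_block_lists_0: "card (disjoint_block_lists 0) = 1"
proof -
  have "bs = []" if "block_list bs" "sum_list (map hd bs) = 0" for bs
    using that by (cases bs; cases "hd bs") auto
  then have "disjoint_block_lists 0 = {[]}"
    by (auto simp: disjoint_block_lists_def simp del: sum_list_eq_0_iff)
  then show ?thesis by simp
qed

theorem theorem3p3:
  fixes n :: nat
  assumes "n \<ge> 1"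
  shows "real (card (strict_multiplex_prime_patterns n)) =
    (\<Sum>\<^sub>\<infinity>t\<in>{1..}. \<Sum>m=1..n-1. real t * c t m) + 1"
proof -
  have "(\<Sum>\<^sub>\<infinity>t\<in>{1..}. \<Sum>m=1..n-1. real t * c t m) = (\<Sum>\<^sub>\<infinity>t\<in>{1..n}. \<Sum>m=1..n-1. real t * c t m)"
    \<comment> \<open>For \<open>t > n\<close> every \<open>m\<close> in range is below
      \<open>t\<close>, so no partition exists and the terms vanish.\<close>
    by (rule infsum_cong_neutral) (auto simp: c_eq_0 intro!: sum.neutral)
  also have "\<dots> = (\<Sum>m=1..n-1. \<Sum>t=1..n. real t * c t m)"
    by (simp add: sum.swap[of _ "{Suc 0..n}"])
  also have "\<dots> = (\<Sum>m=1..n-1. real (card (disjoint_block_lists m)))"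
  proof (rule sum.cong[OF refl])
    fix m assume m: "m \<in> {1..n - 1}"
    then have "(\<Sum>t=1..n. real t * c t m) = (\<Sum>t=1..m. real t * c t m)"
      by (intro sum.mono_neutral_right) (auto simp: c_eq_0)
    then show "(\<Sum>t=1..n. real t * c t m) = real (card (disjoint_block_lists m))"
      using m by (simp add: card_disjoint_block_lists_eq_c)
  qed
  finally have rhs: "(\<Sum>\<^sub>\<infinity>t\<in>{1..}. \<Sum>m=1..n-1. real t * c t m) =
    (\<Sum>m=1..n-1. real (card (disjoint_block_lists m)))" .
  have "card (strict_multiplex_prime_patterns n) = (\<Sum>m\<in>{0..n-1}. card (disjoint_block_lists m))"
    using bij_betw_same_card[OF bij_betw_block_walk[OF assms]] finite_disjoint_block_lists
    by (simp add: card_strict_multiplex_prime_patterns card_SigmaI)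
  also have "\<dots> = 1 + (\<Sum>m=1..n-1. card (disjoint_block_lists m))"
    by (simp add: sum.atLeast_Suc_atMost card_disjoint_block_lists_0)
  finally show ?thesis unfolding rhs by simp
qed

end
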